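(* Let $G=\mathrm{GL}_{2n}(F)$, let $J=\begin{pmatrix}0&1_n\\-1_n&0\end{pmatrix}$, let $K=\mathrm{Sp}_{2n}(F)=\{g\in \mathrm{GL}_{2n}(F): g^TJg=J\}$, and let $B\subset G$ be the Iwahori subgroup. The map $w\mapsto Kg_wB$ is a bijection from $\mathsf{SkewAPM}_{2n}$ to $K\backslash G/B$, where $g_w\in G$ is the explicit affine permutation matrix attached to $w$ defined in the context.
   Context: $n$ is a positive integer. $\mathbb{K}$ is a quadratically closed field, i.e. a field of characteristic not equal to $2$ in which every element has a square root. $F=\mathbb{K}((t))$ and $A=\mathbb{K}[[t]]$. $1_n$ is the $n\times n$ identity matrix. The Iwahori subgroup $B$ is the subgroup of $\mathrm{GL}_{2n}(A)$ consisting of the matrices that become upper triangular upon setting $t=0$. A monomial matrix is a square matrix with exactly one non-zero entry in each row and column. $\mathsf{SkewAPM}_{2n}$ is the set of all skew-symmetric $2n\times 2n$ monomial matrices over $F$ whose non-zero entries above the diagonal are integral powers of $t$. A permutation $\pi\in S_{2n}$ is identified with the permutation matrix satisfying $\pi e_j=e_{\pi(j)}$ for the standard basis vectors $e_j$; products of permutations are compositions of maps (right factor applied first). For $\mathbf{c}\in\mathbb{Z}^{2n}$ put $\tau^{\mathbf{c}}=\mathrm{diag}(t^{c_1},\dots,t^{c_{2n}})$. Let $w\in\mathsf{SkewAPM}_{2n}$. Let $\bar w\in S_{2n}$ be its underlying permutation (a fixed-point-free involution) and let $c_j$ be the exponent of $t$ in the non-zero entry of column $j$, which is $\pm t^{c_j}$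 in row $\bar w(j)$. Write $\bar w=(i_1\,j_1)\cdots(i_n\,j_n)$ as a product of disjoint $2$-cycles with $i_1<\dots<i_n$ and $i_k<j_k$; then $c_{i_k}=c_{j_k}$. Let $w_J=(1\ \,n+1)(2\ \,n+2)\cdots(n\ \,2n)\in S_{2n}$. Define $\sigma_w\in S_{2n}$ recursively: set $\sigma_0=\mathrm{id}$, $w_0=\bar w$; for $j=1,\dots,n$, if $w_{j-1}(j)=j+n$ set $\sigma_j=\sigma_{j-1}$ and $w_j=w_{j-1}$; otherwise let $\rho_j$ be the transposition $(j+n\ \ w_{j-1}(j))$ and set $\sigma_j=\rho_j\sigma_{j-1}$ and $w_j=\rho_jw_{j-1}\rho_j$. Put $\sigma_w=\sigma_n$; it satisfies $\sigma_w^{-1}w_J\sigma_w=\bar w$, so the matrix $\sigma_w^TJ\sigma_w$ is skew-symmetric monomial with entries $\pm1$ in the non-zero positions of $\bar w$. Let $\sqrt{\mathbf{c}}\in\mathbb{Z}^{2n}$ be obtained from $\mathbf{c}=(c_1,\dots,c_{2n})$ by changing the entries $c_{j_k}$ to $0$ for all $k\in\{1,\dots,n\}$. Let $s\in S_{2n}$ be the product of those cycles $(i_k\,j_k)$ for which the $(i_k,j_k)$ entry of $\sigma_w^TJ\sigma_w$ equals $-1$. Finally $g_w=\sigma_w\,\tau^{\sqrt{\mathbf{c}}}\,s\in\mathrm{GL}_{2n}(F)$. *)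

theory Defs
  imports
    "HOL-Computational_Algebra.Formal_Laurent_Series"
    "HOL-Combinatorics.Transposition"
    "Jordan_Normal_Form.Matrix"
begin

text \<open>
  The field $F = k((t))$ is \<^typ>\<open>'k fls\<close> and the ring $A = k[[t]]$ is \<^typ>\<open>'k fps\<close>, regarded
  inside $F$ via \<^const>\<open>fps_to_fls\<close>; the power $t^m$ is \<^term>\<open>fls_X_intpow m\<close>.
  Rows and columns of a matrix, and the points moved by permutations in $S_{2n}$, are numbered
  from 0, i.e. by $0, \dots, 2n-1$ instead of $1, \dots, 2n$.
\<close>

definition quadratically_closed :: "'k::field itself \<Rightarrow> bool" where
  "quadratically_closed _ \<longleftrightarrow> (2::'k) \<noteq> 0 \<and> (\<forall>x::'k. \<exists>y. y ^ 2 = x)"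

definition GL :: "nat \<Rightarrow> 'a::semiring_1 mat set" where
  "GL m = {g \<in> carrier_mat m m. invertible_mat g}"

definition J_mat :: "nat \<Rightarrow> 'a::ring_1 mat" where
  "J_mat n = four_block_mat (0\<^sub>m n n) (1\<^sub>m n) (- 1\<^sub>m n) (0\<^sub>m n n)"

definition Sp :: "nat \<Rightarrow> 'a::comm_ring_1 mat set" where
  "Sp n = {g \<in> GL (2 * n). transpose_mat g * J_mat n * g = J_mat n}"

definition Iwahori :: "nat \<Rightarrow> 'k::field fls mat set" where
  "Iwahori m = map_mat fps_to_fls `
     {g \<in> GL m. upper_triangular (map_mat (\<lambda>f. fps_nth f 0) g)}"

definition double_coset :: "'a::semiring_0 mat set \<Rightarrow> 'a mat \<Rightarrow> 'a mat set \<Rightarrow> 'a mat set" where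
  "double_coset K g B = {k * g * b | k b. k \<in> K \<and> b \<in> B}"

definition double_cosets ::
    "'a::semiring_0 mat set \<Rightarrow> 'a mat set \<Rightarrow> 'a mat set \<Rightarrow> 'a mat set set" where
  "double_cosets K G B = {double_coset K g B | g. g \<in> G}"

definition monomial_mat :: "nat \<Rightarrow> 'a::zero mat \<Rightarrow> bool" where
  "monomial_mat m w \<longleftrightarrow> w \<in> carrier_mat m m \<and>
     (\<forall>i<m. \<exists>!j. j < m \<and> w $$ (i, j) \<noteq> 0) \<and>
     (\<forall>j<m. \<exists>!i. i < m \<and> w $$ (i, j) \<noteq> 0)"

definition SkewAPM :: "nat \<Rightarrow> 'k::field fls mat set" where
  "SkewAPM m = {w. monomial_mat m w \<and> transpose_mat w = - w \<and>
     (\<forall>i j. i < j \<and> j < m \<and> w $$ (i, j) \<noteq> 0 \<longrightarrow> (\<exists>e::int. w $$ (i, j) = fls_X_intpow e))}"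

text \<open>Matrix of a permutation, sending the basis vector $e_j$ to $e_{\pi(j)}$.\<close>

definition perm_mat :: "nat \<Rightarrow> (nat \<Rightarrow> nat) \<Rightarrow> 'a::{zero,one} mat" where
  "perm_mat m \<pi> = mat m m (\<lambda>(i, j). if i = \<pi> j then 1 else 0)"

definition tau_mat :: "nat \<Rightarrow> (nat \<Rightarrow> int) \<Rightarrow> 'k::field fls mat" where
  "tau_mat m c = mat_diag m (\<lambda>j. fls_X_intpow (c j))"

definition underlying_perm :: "'a::zero mat \<Rightarrow> nat \<Rightarrow> nat" where
  "underlying_perm w j =
     (if j < dim_col w then THE i. i < dim_row w \<and> w $$ (i, j) \<noteq> 0 else j)"

definition exponent :: "'k::field fls mat \<Rightarrow> nat \<Rightarrow> int" where
  "exponent w j = fls_subdegree (w $$ (underlying_perm w j, j))"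

text \<open>
  The recursion defining $\sigma_w$. Because of the numbering from 0, step \<open>Suc j\<close> acts on the
  point \<open>j\<close>: it conjugates the current involution such that \<open>j\<close> becomes paired with \<open>j + n\<close>.
\<close>

definition rho :: "nat \<Rightarrow> (nat \<Rightarrow> nat) \<Rightarrow> nat \<Rightarrow> nat \<Rightarrow> nat" where
  "rho n u j = transpose (j + n) (u j)"

primrec involution_step :: "nat \<Rightarrow> (nat \<Rightarrow> nat) \<Rightarrow> nat \<Rightarrow> nat \<Rightarrow> nat" where
  "involution_step n u 0 = u"
| "involution_step n u (Suc j) =
     (let v = involution_step n u j in
      if v j = j + n then v else rho n v j \<circ> v \<circ> rho n v j)"

primrec sigma_step :: "nat \<Rightarrow> (nat \<Rightarrow> nat) \<Rightarrow> nat \<Rightarrow> nat \<Rightarrow> nat" where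
  "sigma_step n u 0 = id"
| "sigma_step n u (Suc j) =
     (let v = involution_step n u j in
      if v j = j + n then sigma_step n u j else rho n v j \<circ> sigma_step n u j)"

definition sigma :: "nat \<Rightarrow> 'a::zero mat \<Rightarrow> nat \<Rightarrow> nat" where
  "sigma n w = sigma_step n (underlying_perm w) n"

text \<open>
  The larger points $j_k$ of the 2-cycles $(i_k\,j_k)$ of the underlying permutation are exactly
  the points which it maps to a smaller one.
\<close>

definition sqrt_exponent :: "'k::field fls mat \<Rightarrow> nat \<Rightarrow> int" where
  "sqrt_exponent w j = (if underlying_perm w j < j then 0 else exponent w j)"

text \<open>
  The product of the 2-cycles $(i_k\,j_k)$ at which $\sigma_w^T J \sigma_w$ has entry $-1$; the
  2-cycle containing the point \<open>j\<close> consists of \<open>j\<close> and \<open>underlying_perm w j\<close>.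
\<close>

definition sign_perm :: "nat \<Rightarrow> 'k::field fls mat \<Rightarrow> nat \<Rightarrow> nat" where
  "sign_perm n w j =
     (let P = perm_mat (2 * n) (sigma n w) :: 'k fls mat;
          i = underlying_perm w j
      in if j < 2 * n \<and> (transpose_mat P * J_mat n * P) $$ (min i j, max i j) = -1
         then i else j)"

definition g_mat :: "nat \<Rightarrow> 'k::field fls mat \<Rightarrow> 'k fls mat" where
  "g_mat n w = perm_mat (2 * n) (sigma n w) * tau_mat (2 * n) (sqrt_exponent w)
     * perm_mat (2 * n) (sign_perm n w)"

end

theory Submission
  imports Defs "Jordan_Normal_Form.Determinant"
begin

text \<open>
  Let \<open>m = 2n\<close>, and let \<open>v\<close> be the \<open>t\<close>-adic valuation. The map \<open>g \<mapsto> g\<^sup>T J g\<close> has the left translates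
  of the symplectic group as its fibres and turns right multiplication by \<open>b\<close> into the congruence
  \<open>X \<mapsto> b\<^sup>T X b\<close>. As \<open>g\<^sub>w\<^sup>T J g\<^sub>w = w\<close> (lemma \<open>g_mat_Gram\<close>), the theorem follows once each invertible
  skew-symmetric matrix is known to be congruent under the Iwahori subgroup to exactly one signed monomial matrix
  of the prescribed form. Surjectivity needs this for matrices \<open>g\<^sup>T J g\<close> only, so the classification
  of symplectic forms plays no role.

  Both halves rest on one weight. Iwahori matrices satisfy \<open>m v(b\<^sub>i\<^sub>j) \<ge> i - j\<close>, with equality exactly on
  the diagonal (with \<open>v(0) = \<infinity>\<close>), so the minimum over all entries of \<open>m v(X\<^sub>i\<^sub>j) + i + j\<close> does not change
  when \<open>X\<close> is replaced by \<open>b\<^sup>T X b\<close>.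

  Existence (\<open>exists_SkewAPM_congr\<close>): take a non-zero entry of minimal weight as a pivot. The column
  operations that clear the two pivot rows have coefficients \<open>- X\<^sub>i\<^sub>q / X\<^sub>i\<^sub>j\<close> and
  \<open>- X\<^sub>j\<^sub>q / X\<^sub>j\<^sub>i\<close>, and minimality says that these are allowed in the Iwahori subgroup; the unit
  part of the pivot is absorbed by scaling one column. The remaining rows and columns are treated in the same way.

  Uniqueness (\<open>SkewAPM_congr_unique\<close>): let \<open>w' = b\<^sup>T w b\<close>. Comparing entries in \<open>w' b\<^sup>-\<^sup>1 = b\<^sup>T w\<close> shows
  that the weight of \<open>w'\<close> in column \<open>i\<close> is at least the weight of \<open>w\<close> in the column that \<open>w'\<close> pairs
  with \<open>i\<close>. Summing over all columns and exchanging \<open>w\<close> and \<open>w'\<close> makes all these inequalities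
  equalities, which forces the permutations, and then the exponents, to agree.

  Since the characteristic is not 2, the diagonal of a skew-symmetric matrix vanishes, so that pivots
  lie off the diagonal.
\<close>

section \<open>Matrix entries and invertible matrices\<close>

lemma mult_entry:
  assumes "A \<in> carrier_mat l m" "B \<in> carrier_mat m r" "i < l" "j < r"
  shows "(A * B) $$ (i, j) = (\<Sum>k<m. A $$ (i, k) * B $$ (k, j))"
  using assms by (auto simp: scalar_prod_def lessThan_atLeast0)

lemma GL_iff:
  "g \<in> GL m \<longleftrightarrow> g \<in> carrier_mat m m \<and> (\<exists>h\<in>carrier_mat m m. g * h = 1\<^sub>m m \<and> h * g = 1\<^sub>m m)"
proof
  assume "g \<in> GL m"
  then obtain h where g: "g \<in> carrier_mat m m" and gh: "g * h = 1\<^sub>m m"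
    and hg: "h * g = 1\<^sub>m (dim_row h)"
    by (auto simp: GL_def invertible_mat_def inverts_mat_def)
  have "dim_col h = m" using arg_cong[OF gh, of dim_col] by simp
  moreover have "dim_row h = m" using arg_cong[OF hg, of dim_col] g by simp
  ultimately have "h \<in> carrier_mat m m" by auto
  then show "g \<in> carrier_mat m m \<and> (\<exists>h\<in>carrier_mat m m. g * h = 1\<^sub>m m \<and> h * g = 1\<^sub>m m)"
    using g gh hg by auto
qed (auto simp: GL_def invertible_mat_def inverts_mat_def)

lemma GL_carrier: "g \<in> GL m \<Longrightarrow> g \<in> carrier_mat m m"
  by (simp add: GL_def)

lemma GL_inverse:
  assumes "g \<in> GL m"
  obtains h where "h \<in> GL m" "g * h = 1\<^sub>m m" "h * g = 1\<^sub>m m"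
  using assms unfolding GL_iff by blast

lemma GL_I:
  "g \<in> carrier_mat m m \<Longrightarrow> h \<in> carrier_mat m m \<Longrightarrow> g * h = 1\<^sub>m m \<Longrightarrow> h * g = 1\<^sub>m m \<Longrightarrow> g \<in> GL m"
  unfolding GL_iff by blast

lemma GL_one: "1\<^sub>m m \<in> GL m"
  unfolding GL_iff by (auto intro!: bexI[of _ "1\<^sub>m m"])

lemma GL_mult:
  assumes "g \<in> GL m" "h \<in> GL m"
  shows "g * h \<in> GL m"
proof -
  note g = GL_carrier[OF assms(1)] and h = GL_carrier[OF assms(2)]
  obtain g' where g': "g' \<in> GL m" "g * g' = 1\<^sub>m m" "g' * g = 1\<^sub>m m" by (rule GL_inverse[OF assms(1)])
  obtain h' where h': "h' \<in> GL m" "h * h' = 1\<^sub>m m" "h' * h = 1\<^sub>m m" by (rule GL_inverse[OF assms(2)])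
  note cg = GL_carrier[OF g'(1)] and ch = GL_carrier[OF h'(1)]
  have "(g * h) * (h' * g') = g * (h * h') * g'"
    using g h cg ch by (simp add: assoc_mult_mat[of _ m m _ m _ m])
  moreover have "(h' * g') * (g * h) = h' * (g' * g) * h"
    using g h cg ch by (simp add: assoc_mult_mat[of _ m m _ m _ m])
  ultimately show ?thesis
    using g h g' h' cg ch by (intro GL_I[of "g * h" m "h' * g'"]) simp_all
qed

lemma GL_transpose:
  fixes g :: "'a::comm_ring_1 mat"
  assumes "g \<in> GL m"
  shows "transpose_mat g \<in> GL m"
proof -
  obtain h where h: "h \<in> GL m" "g * h = 1\<^sub>m m" "h * g = 1\<^sub>m m" by (rule GL_inverse[OF assms])
  note c = GL_carrier[OF assms] GL_carrier[OF h(1)]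
  have "transpose_mat g * transpose_mat h = 1\<^sub>m m" "transpose_mat h * transpose_mat g = 1\<^sub>m m"
    by (simp_all flip: transpose_mult[OF c] transpose_mult[OF c(2,1)] add: h transpose_one)
  with c show ?thesis by (intro GL_I[of _ _ "transpose_mat h"]) simp_all
qed

lemma GL_iff_det_unit:
  fixes g :: "'a::comm_ring_1 mat"
  assumes g: "g \<in> carrier_mat m m"
  shows "g \<in> GL m \<longleftrightarrow> det g dvd 1"
proof
  assume "g \<in> GL m"
  then obtain h where h: "h \<in> GL m" "g * h = 1\<^sub>m m" by (rule GL_inverse)
  then have "det g * det h = 1" using det_mult[OF g GL_carrier[OF h(1)]] by simp
  then show "det g dvd 1" by (metis dvd_triv_left)
next
  assume "det g dvd 1"
  then obtain u where u: "det g * u = 1" by (metis dvdE)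
  define h where "h = u \<cdot>\<^sub>m adj_mat g"
  have "h \<in> carrier_mat m m" "g * h = 1\<^sub>m m" "h * g = 1\<^sub>m m"
    using adj_mat[OF g] g u
    by (auto simp: h_def mult_smult_distrib[of g m m] mult_smult_assoc_mat[of _ m m]
      mult.commute[of u] intro!: eq_matI)
  then show "g \<in> GL m" unfolding GL_iff using g by auto
qed

lemma GL_left_inverse:
  fixes g :: "'a::field mat"
  assumes "g \<in> carrier_mat m m" "h \<in> carrier_mat m m" "h * g = 1\<^sub>m m"
  shows "g \<in> GL m"
  unfolding GL_iff using assms mat_mult_left_right_inverse[OF assms(2,1)] by auto

section \<open>The symplectic group and Gram matrices\<close>

lemma J_carrier: "J_mat n \<in> carrier_mat (2 * n) (2 * n)"
  unfolding J_mat_def mult_2 by simp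

lemma J_dims [simp]: "dim_row (J_mat n) = 2 * n" "dim_col (J_mat n) = 2 * n"
  using J_carrier[of n] by auto

lemma J_entry:
  assumes "a < 2 * n" "b < 2 * n"
  shows "J_mat n $$ (a, b) = (if b = a + n then 1 else if a = b + n then - 1 else 0)"
  using assms unfolding J_mat_def by (subst index_mat_four_block) auto

lemma J_skew: "transpose_mat (J_mat n) = - J_mat n"
  by (intro eq_matI) (auto simp: J_entry)

lemma J_GL: "(J_mat n :: 'a::comm_ring_1 mat) \<in> GL (2 * n)"
proof -
  have "J_mat n * (- J_mat n :: 'a mat) = 1\<^sub>m (2 * n)"
  proof (rule eq_matI)
    fix i j assume "i < dim_row (1\<^sub>m (2 * n))" "j < dim_col (1\<^sub>m (2 * n))"
    then have ij: "i < 2 * n" "j < 2 * n" by auto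
    define i' where "i' = (if i < n then i + n else i - n)"
    have i': "i' < 2 * n" using ij by (auto simp: i'_def)
    have "(J_mat n * (- J_mat n :: 'a mat)) $$ (i, j)
        = (\<Sum>k<2*n. J_mat n $$ (i, k) * (- J_mat n :: 'a mat) $$ (k, j))"
      by (rule mult_entry) (use J_carrier[of n] ij in auto)
    also have "\<dots> = (\<Sum>k<2*n. if k = i' then J_mat n $$ (i, i') * (- J_mat n :: 'a mat) $$ (i', j) else 0)"
      by (intro sum.cong) (use ij in \<open>auto simp: J_entry i'_def index_uminus_mat\<close>)
    also have "\<dots> = J_mat n $$ (i, i') * (- J_mat n :: 'a mat) $$ (i', j)"
      using i' by simp
    also have "\<dots> = (if i = j then 1 else 0)"
      using ij i' by (auto simp: J_entry i'_def)
    finally show "(J_mat n * (- J_mat n :: 'a mat)) $$ (i, j) = 1\<^sub>m (2 * n) $$ (i, j)"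
      using ij by simp
  qed (use J_carrier[of n] in auto)
  moreover have "(- J_mat n :: 'a mat) * J_mat n = J_mat n * - J_mat n"
    using J_carrier[of n] by (metis uminus_mult_left_mat uminus_mult_right_mat carrier_matD)
  ultimately show ?thesis unfolding GL_iff using J_carrier[of n]
    by (auto intro!: bexI[of _ "- J_mat n"])
qed

text \<open>The matrix \<open>b\<^sup>T X b\<close> of the bilinear form \<open>X\<close> after the change of basis \<open>b\<close>.\<close>

definition congr_mat :: "'a::comm_ring_1 mat \<Rightarrow> 'a mat \<Rightarrow> 'a mat" where
  "congr_mat b X = transpose_mat b * X * b"

lemma congr_carrier:
  "b \<in> carrier_mat m m \<Longrightarrow> X \<in> carrier_mat m m \<Longrightarrow> congr_mat b X \<in> carrier_mat m m"
  by (simp add: congr_mat_def)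

lemma congr_one: "X \<in> carrier_mat m m \<Longrightarrow> congr_mat (1\<^sub>m m) X = X"
  by (simp add: congr_mat_def transpose_one)

lemma congr_mult:
  assumes "a \<in> carrier_mat m m" "b \<in> carrier_mat m m" "X \<in> carrier_mat m m"
  shows "congr_mat (a * b) X = congr_mat b (congr_mat a X)"
  using assms by (simp add: congr_mat_def transpose_mult[OF assms(1,2)]
      assoc_mult_mat[of _ m m _ m _ m])

lemma congr_GL: "b \<in> GL m \<Longrightarrow> X \<in> GL m \<Longrightarrow> congr_mat b X \<in> GL m"
  by (simp add: congr_mat_def GL_mult GL_transpose)

lemma congr_skew:
  assumes "b \<in> carrier_mat m m" "X \<in> carrier_mat m m" "transpose_mat X = - X"
  shows "transpose_mat (congr_mat b X) = - congr_mat b X"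
proof -
  have "transpose_mat (congr_mat b X) = transpose_mat b * (- X) * b"
    using assms by (simp add: congr_mat_def transpose_mult[of _ m m _ m] assoc_mult_mat[of _ m m _ m _ m])
  also have "\<dots> = - congr_mat b X"
    using assms by (simp add: congr_mat_def)
  finally show ?thesis .
qed

lemma Sp_iff: "k \<in> Sp n \<longleftrightarrow> k \<in> GL (2 * n) \<and> congr_mat k (J_mat n) = J_mat n"
  by (auto simp: Sp_def congr_mat_def)

lemma Sp_one: "1\<^sub>m (2 * n) \<in> Sp n"
  by (simp add: Sp_iff GL_one congr_one[OF J_carrier])

lemma Sp_mult: "k \<in> Sp n \<Longrightarrow> l \<in> Sp n \<Longrightarrow> k * l \<in> Sp n"
  using congr_mult[OF GL_carrier GL_carrier J_carrier, of k n l] by (simp add: Sp_iff GL_mult)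

lemma Sp_inverse:
  assumes "k \<in> Sp n"
  obtains l where "l \<in> Sp n" "k * l = 1\<^sub>m (2 * n)" "l * k = 1\<^sub>m (2 * n)"
proof -
  have k: "k \<in> GL (2 * n)" "congr_mat k (J_mat n) = J_mat n" using assms by (simp_all add: Sp_iff)
  obtain l where l: "l \<in> GL (2 * n)" "k * l = 1\<^sub>m (2 * n)" "l * k = 1\<^sub>m (2 * n)"
    by (rule GL_inverse[OF k(1)])
  have "congr_mat l (J_mat n) = congr_mat (k * l) (J_mat n)"
    using congr_mult[OF GL_carrier[OF k(1)] GL_carrier[OF l(1)] J_carrier] k by simp
  then have "l \<in> Sp n" using l by (simp add: Sp_iff congr_one[OF J_carrier])
  then show ?thesis using l that by blast
qed

text \<open>Left translates under the symplectic group are the fibres of \<open>g \<mapsto> g\<^sup>T J g\<close>.\<close>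

lemma same_Gram_imp_Sp_translate:
  assumes g: "g \<in> GL (2 * n)" and h: "h \<in> GL (2 * n)"
    and eq: "congr_mat g (J_mat n) = congr_mat h (J_mat n)"
  obtains k where "k \<in> Sp n" "g = k * h"
proof -
  obtain h' where h': "h' \<in> GL (2 * n)" "h * h' = 1\<^sub>m (2 * n)" "h' * h = 1\<^sub>m (2 * n)"
    by (rule GL_inverse[OF h])
  note c = GL_carrier[OF g] GL_carrier[OF h] GL_carrier[OF h'(1)]
  have "congr_mat (g * h') (J_mat n) = congr_mat (h * h') (J_mat n)"
    using congr_mult[OF c(1,3) J_carrier] congr_mult[OF c(2,3) J_carrier] eq by simp
  then have "g * h' \<in> Sp n"
    using h' g by (simp add: Sp_iff congr_one[OF J_carrier] GL_mult)
  moreover have "g = g * h' * h"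
    using c h' by (simp add: assoc_mult_mat[of _ "2*n" "2*n" _ "2*n" _ "2*n"])
  ultimately show ?thesis using that by blast
qed

section \<open>The Iwahori subgroup\<close>

lemma comm_ring_hom_constant_term:
  "comm_ring_hom (\<lambda>f::'a::comm_ring_1 fps. fps_nth f 0)"
  by unfold_locales simp_all

lemma comm_ring_hom_fps_to_fls:
  "comm_ring_hom (fps_to_fls :: 'a::comm_ring_1 fps \<Rightarrow> 'a fls)"
  by unfold_locales (simp_all add: fls_times_fps_to_fls)

lemma map_mat_constant_term_mult:
  fixes g h :: "'a::comm_ring_1 fps mat"
  assumes "g \<in> carrier_mat m m" "h \<in> carrier_mat m m"
  shows "map_mat (\<lambda>f. fps_nth f 0) (g * h)
    = map_mat (\<lambda>f. fps_nth f 0) g * map_mat (\<lambda>f. fps_nth f 0) h"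
proof -
  interpret comm_ring_hom "\<lambda>f::'a fps. fps_nth f 0" by (rule comm_ring_hom_constant_term)
  show ?thesis by (rule mat_hom_mult[OF assms])
qed

lemma map_mat_fps_to_fls_mult:
  fixes g h :: "'a::comm_ring_1 fps mat"
  assumes "g \<in> carrier_mat m m" "h \<in> carrier_mat m m"
  shows "map_mat fps_to_fls (g * h) = map_mat fps_to_fls g * map_mat fps_to_fls h"
proof -
  interpret comm_ring_hom "fps_to_fls :: 'a fps \<Rightarrow> 'a fls" by (rule comm_ring_hom_fps_to_fls)
  show ?thesis by (rule mat_hom_mult[OF assms])
qed

lemma upper_triangular_det_iff:
  fixes g :: "'a::field mat"
  assumes g: "g \<in> carrier_mat m m" and ut: "upper_triangular g"
  shows "det g \<noteq> 0 \<longleftrightarrow> (\<forall>i<m. g $$ (i, i) \<noteq> 0)"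
  using upper_triangular_imp_det_eq_0_iff[OF g ut] g by (auto simp: diag_mat_def)

lemma upper_triangular_mult:
  fixes g h :: "'a::semiring_0 mat"
  assumes g: "g \<in> carrier_mat m m" and h: "h \<in> carrier_mat m m"
    and utg: "upper_triangular g" and uth: "upper_triangular h"
  shows "upper_triangular (g * h)"
proof (rule upper_triangularI)
  fix i j assume ij: "j < i" "i < dim_row (g * h)"
  have "g $$ (i, k) * h $$ (k, j) = 0" if "k < m" for k
    using upper_triangularD[OF utg, of k i] upper_triangularD[OF uth, of j k] that ij g h
    by (cases "k < i") auto
  then show "(g * h) $$ (i, j) = 0"
    using ij g h by (subst mult_entry[OF g h]) auto
qed

lemma upper_triangular_inverse:
  fixes g h :: "'a::field mat"
  assumes g: "g \<in> carrier_mat m m" and h: "h \<in> carrier_mat m m"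
    and gh: "g * h = 1\<^sub>m m" and ut: "upper_triangular g"
  shows "upper_triangular h"
proof -
  have "g \<in> GL m"
    using g h gh mat_mult_left_right_inverse[OF g h gh] by (intro GL_I) auto
  then have diag: "g $$ (i, i) \<noteq> 0" if "i < m" for i
    using upper_triangular_det_iff[OF g ut] that GL_iff_det_unit[OF g] by auto
  have "h $$ (i, j) = 0" if "i < m" "j < i" for i j
    using that
  proof (induction "m - i" arbitrary: i rule: less_induct)
    case less
    have "0 = (g * h) $$ (i, j)" using less.prems gh by simp
    also have "\<dots> = (\<Sum>k<m. g $$ (i, k) * h $$ (k, j))"
      using less.prems by (intro mult_entry[OF g h]) auto
    also have "\<dots> = (\<Sum>k<m. if k = i then g $$ (i, i) * h $$ (i, j) else 0)"
    proof (rule sum.cong)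
      fix k assume "k \<in> {..<m}"
      then show "g $$ (i, k) * h $$ (k, j) = (if k = i then g $$ (i, i) * h $$ (i, j) else 0)"
        using upper_triangularD[OF ut, of k i] less.hyps[of k] less.prems g
        by (cases k i rule: linorder_cases) auto
    qed simp
    also have "\<dots> = g $$ (i, i) * h $$ (i, j)" using less.prems by simp
    finally show "h $$ (i, j) = 0" using diag less.prems by simp
  qed
  then show ?thesis using h by (auto intro!: upper_triangularI)
qed

lemma Iwahori_iff:
  fixes b :: "'k::field fls mat"
  shows "b \<in> Iwahori m \<longleftrightarrow> b \<in> carrier_mat m m \<and>
    (\<forall>i<m. \<forall>j<m. 0 \<le> fls_subdegree (b $$ (i, j))
       \<and> (j < i \<longrightarrow> fls_nth (b $$ (i, j)) 0 = 0) \<and> fls_nth (b $$ (i, i)) 0 \<noteq> 0)"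
    (is "_ \<longleftrightarrow> ?R")
proof -
  let ?c = "\<lambda>f::'k fps. fps_nth f 0"
  have unit: "g \<in> GL m \<longleftrightarrow> (\<forall>i<m. ?c (g $$ (i, i)) \<noteq> 0)"
    if g: "g \<in> carrier_mat m m" and ut: "upper_triangular (map_mat ?c g)" for g
  proof -
    have "g \<in> GL m \<longleftrightarrow> det (map_mat ?c g) \<noteq> 0"
      unfolding GL_iff_det_unit[OF g] fps_is_unit_iff
      by (simp add: comm_ring_hom.hom_det[OF comm_ring_hom_constant_term])
    also have "\<dots> \<longleftrightarrow> (\<forall>i<m. ?c (g $$ (i, i)) \<noteq> 0)"
      using upper_triangular_det_iff[OF _ ut, of m] g by auto
    finally show ?thesis .
  qed
  show ?thesis
  proof
    assume "b \<in> Iwahori m"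
    then obtain g where b: "b = map_mat fps_to_fls g" and g: "g \<in> GL m"
      and ut: "upper_triangular (map_mat ?c g)"
      by (auto simp: Iwahori_def)
    have gc: "g \<in> carrier_mat m m" by (rule GL_carrier[OF g])
    show ?R
      using unit[OF gc ut] g gc upper_triangularD[OF ut]
      by (auto simp: b fls_subdegree_fls_to_fps_gt0)
  next
    assume R: ?R
    define g where "g = map_mat fls_regpart b"
    have gc: "g \<in> carrier_mat m m" using R by (simp add: g_def)
    have ut: "upper_triangular (map_mat ?c g)"
      using R by (auto intro!: upper_triangularI simp: g_def)
    have "g \<in> GL m" unfolding unit[OF gc ut] using R by (auto simp: g_def)
    moreover have "b = map_mat fps_to_fls g"
      using R by (auto intro!: eq_matI simp: g_def)
    ultimately show "b \<in> Iwahori m" using ut by (auto simp: Iwahori_def)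
  qed
qed

lemma Iwahori_one: "1\<^sub>m m \<in> Iwahori m"
  by (simp add: Iwahori_iff)

lemma Iwahori_carrier: "b \<in> Iwahori m \<Longrightarrow> b \<in> carrier_mat m m"
  by (simp add: Iwahori_iff)

lemma Iwahori_mult:
  assumes "a \<in> Iwahori m" "b \<in> Iwahori m"
  shows "a * b \<in> Iwahori m"
proof -
  let ?c = "\<lambda>f::'a fps. fps_nth f 0"
  obtain g h where g: "g \<in> GL m" "upper_triangular (map_mat ?c g)" "a = map_mat fps_to_fls g"
    and h: "h \<in> GL m" "upper_triangular (map_mat ?c h)" "b = map_mat fps_to_fls h"
    using assms by (auto simp: Iwahori_def)
  note c = GL_carrier[OF g(1)] GL_carrier[OF h(1)]
  have "map_mat ?c (g * h) = map_mat ?c g * map_mat ?c h"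
    by (rule map_mat_constant_term_mult[OF c])
  then have "upper_triangular (map_mat ?c (g * h))"
    using upper_triangular_mult[of "map_mat ?c g" m "map_mat ?c h"] g h c by simp
  moreover have "a * b = map_mat fps_to_fls (g * h)"
    using map_mat_fps_to_fls_mult[OF c] g h by simp
  ultimately show ?thesis using GL_mult[OF g(1) h(1)] by (auto simp: Iwahori_def)
qed

lemma Iwahori_inverse:
  assumes "b \<in> Iwahori m"
  obtains b' where "b' \<in> Iwahori m" "b * b' = 1\<^sub>m m" "b' * b = 1\<^sub>m m"
proof -
  let ?c = "\<lambda>f::'a fps. fps_nth f 0"
  obtain g where g: "g \<in> GL m" "upper_triangular (map_mat ?c g)" "b = map_mat fps_to_fls g"
    using assms by (auto simp: Iwahori_def)
  obtain h where h: "h \<in> GL m" "g * h = 1\<^sub>m m" "h * g = 1\<^sub>m m" by (rule GL_inverse[OF g(1)])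
  note c = GL_carrier[OF g(1)] GL_carrier[OF h(1)]
  have one: "map_mat ?c (1\<^sub>m m) = 1\<^sub>m m" "map_mat fps_to_fls (1\<^sub>m m :: 'a fps mat) = 1\<^sub>m m"
    by (auto intro!: eq_matI)
  have "map_mat ?c g * map_mat ?c h = 1\<^sub>m m" using map_mat_constant_term_mult[OF c] h one by simp
  then have "upper_triangular (map_mat ?c h)"
    using upper_triangular_inverse[of "map_mat ?c g" m "map_mat ?c h"] g c by simp
  then have "map_mat fps_to_fls h \<in> Iwahori m" using h by (auto simp: Iwahori_def)
  moreover have "b * map_mat fps_to_fls h = 1\<^sub>m m" "map_mat fps_to_fls h * b = 1\<^sub>m m"
    using map_mat_fps_to_fls_mult[OF c] map_mat_fps_to_fls_mult[OF c(2,1)] g h one by simp_all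
  ultimately show ?thesis using that by blast
qed

lemma Iwahori_GL: "b \<in> Iwahori m \<Longrightarrow> b \<in> GL m"
  by (metis Iwahori_inverse Iwahori_carrier GL_I)

text \<open>
  In an Iwahori matrix, \<open>m v(b\<^sub>i\<^sub>j) \<ge> i - j\<close>, where equality is possible on the diagonal only. This
  inequality states triangularity and integrality at once; it makes
  \<open>m v(X\<^sub>i\<^sub>j) + i + j\<close> the natural weight of an entry of a bilinear form \<open>X\<close>.
\<close>

lemma Iwahori_weight:
  assumes "b \<in> Iwahori m" "i < m" "j < m" "b $$ (i, j) \<noteq> 0"
  shows "int i - int j \<le> int m * fls_subdegree (b $$ (i, j))"
    and "int i - int j = int m * fls_subdegree (b $$ (i, j)) \<Longrightarrow> i = j"
proof -
  let ?v = "fls_subdegree (b $$ (i, j))"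
  have v: "0 \<le> ?v" "j < i \<Longrightarrow> fls_nth (b $$ (i, j)) 0 = 0"
    using assms by (auto simp: Iwahori_iff)
  have "?v \<noteq> 0" if "j < i"
    using v(2)[OF that] nth_fls_subdegree_nonzero[OF assms(4)] by metis
  then have pos: "int m \<le> int m * ?v" if "j < i"
    using v that mult_left_mono[of 1 ?v "int m"] by force
  show "int i - int j \<le> int m * ?v"
  proof (cases "j < i")
    case True
    with pos assms(2) show ?thesis by linarith
  next
    case False
    moreover have "0 \<le> int m * ?v" using v by simp
    ultimately show ?thesis by linarith
  qed
  show "i = j" if "int i - int j = int m * ?v"
  proof (cases "j < i")
    case True
    with pos that assms(2) show ?thesis by linarith
  next
    case False
    moreover have "0 \<le> int m * ?v" using v by simp
    ultimately show ?thesis using that by linarith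
  qed
qed

lemma Iwahori_I:
  assumes b: "b \<in> carrier_mat m m"
    and diag: "\<And>i. i < m \<Longrightarrow> b $$ (i, i) \<noteq> 0 \<and> fls_subdegree (b $$ (i, i)) = 0"
    and off: "\<And>i j. i < m \<Longrightarrow> j < m \<Longrightarrow> i \<noteq> j \<Longrightarrow> b $$ (i, j) \<noteq> 0 \<Longrightarrow>
      int i - int j \<le> int m * fls_subdegree (b $$ (i, j))"
  shows "b \<in> Iwahori m"
  unfolding Iwahori_iff
proof (intro conjI allI impI b)
  fix i j assume ij: "i < m" "j < m"
  show "0 \<le> fls_subdegree (b $$ (i, j))"
  proof (cases "i = j \<or> b $$ (i, j) = 0")
    case False
    have "- int m < int m * fls_subdegree (b $$ (i, j))" using off[OF ij] False ij by auto
    then have "0 < int m * (fls_subdegree (b $$ (i, j)) + 1)" by (simp add: algebra_simps)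
    then show ?thesis by (auto simp: zero_less_mult_iff)
  qed (use diag[OF ij(1)] in auto)
  show "fls_nth (b $$ (i, i)) 0 \<noteq> 0"
    using diag[OF ij(1)] nth_fls_subdegree_nonzero[of "b $$ (i, i)"] by simp
  assume "j < i"
  show "fls_nth (b $$ (i, j)) 0 = 0"
  proof (cases "b $$ (i, j) = 0")
    case False
    have "0 < int m * fls_subdegree (b $$ (i, j))" using off[OF ij] False \<open>j < i\<close> by auto
    then show ?thesis by (simp add: zero_less_mult_iff)
  qed simp
qed

lemma Iwahori_diag:
  assumes "b \<in> Iwahori m" "i < m"
  shows "b $$ (i, i) \<noteq> 0" and "fls_subdegree (b $$ (i, i)) = 0"
proof -
  have "0 \<le> fls_subdegree (b $$ (i, i))" and nz: "fls_nth (b $$ (i, i)) 0 \<noteq> 0"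
    using assms by (auto simp: Iwahori_iff)
  then show "fls_subdegree (b $$ (i, i)) = 0" using fls_subdegree_leI[OF nz] by simp
  show "b $$ (i, i) \<noteq> 0" using nz by auto
qed

section \<open>Skew-symmetric monomial matrices\<close>

lemma skew_entry:
  assumes "X \<in> carrier_mat m m" "transpose_mat X = - X" "i < m" "j < m"
  shows "X $$ (i, j) = - X $$ (j, i)"
  using assms by (metis carrier_matD index_transpose_mat(1) index_uminus_mat(1))

lemma skew_diag:
  fixes X :: "'k::field fls mat"
  assumes "(2::'k) \<noteq> 0" "X \<in> carrier_mat m m" "transpose_mat X = - X" "i < m"
  shows "X $$ (i, i) = 0"
proof (rule fls_eqI)
  fix e
  have "fls_nth (X $$ (i, i)) e = - fls_nth (X $$ (i, i)) e"
    using arg_cong[OF skew_entry[OF assms(2-4,4)], of "\<lambda>f. fls_nth f e"] by simp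
  then have "2 * fls_nth (X $$ (i, i)) e = 0"
    unfolding mult_2 by (metis add.right_inverse)
  then show "fls_nth (X $$ (i, i)) e = fls_nth 0 e" using assms(1) by simp
qed

lemma skew_eqI:
  fixes X Y :: "'k::field fls mat"
  assumes char: "(2::'k) \<noteq> 0"
    and X: "X \<in> carrier_mat m m" "transpose_mat X = - X"
    and Y: "Y \<in> carrier_mat m m" "transpose_mat Y = - Y"
    and up: "\<And>i j. i < j \<Longrightarrow> j < m \<Longrightarrow> X $$ (i, j) = Y $$ (i, j)"
  shows "X = Y"
proof (rule eq_matI)
  fix i j assume "i < dim_row Y" "j < dim_col Y"
  then have ij: "i < m" "j < m" using Y by auto
  consider "i < j" | "i = j" | "j < i" by linarith
  then show "X $$ (i, j) = Y $$ (i, j)"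
  proof cases
    case 1
    then show ?thesis using up ij by simp
  next
    case 2
    then show ?thesis using skew_diag[OF char X ij(1)] skew_diag[OF char Y ij(1)] by simp
  next
    case 3
    then show ?thesis using up[OF 3 ij(1)] skew_entry[OF X ij] skew_entry[OF Y ij] by simp
  qed
qed (use X Y in auto)

lemma underlying_perm_eqI:
  assumes w: "monomial_mat m w" and ij: "i < m" "j < m" "w $$ (i, j) \<noteq> 0"
  shows "underlying_perm w j = i"
proof -
  have "w \<in> carrier_mat m m" and ex: "\<exists>!i. i < m \<and> w $$ (i, j) \<noteq> 0"
    using w ij by (auto simp: monomial_mat_def)
  then show ?thesis
    using the1_equality[OF ex, of i] ij by (simp add: underlying_perm_def)
qed

context
  fixes w :: "'k::field fls mat" and m :: nat
  assumes char: "(2::'k) \<noteq> 0" and w: "w \<in> SkewAPM m"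
begin

lemma SkewAPM_monomial: "monomial_mat m w"
  and SkewAPM_carrier: "w \<in> carrier_mat m m"
  and SkewAPM_skew: "transpose_mat w = - w"
  using w by (simp_all add: SkewAPM_def monomial_mat_def)

lemma SkewAPM_perm:
  assumes "j < m"
  shows "underlying_perm w j < m" and "w $$ (underlying_perm w j, j) \<noteq> 0"
proof -
  obtain i where "i < m" "w $$ (i, j) \<noteq> 0"
    using SkewAPM_monomial assms unfolding monomial_mat_def by blast
  then show "underlying_perm w j < m" "w $$ (underlying_perm w j, j) \<noteq> 0"
    using underlying_perm_eqI[OF SkewAPM_monomial, of i j] assms by auto
qed

lemma SkewAPM_perm_invol:
  assumes "j < m"
  shows "underlying_perm w (underlying_perm w j) = j"
  using SkewAPM_perm[OF assms] skew_entry[OF SkewAPM_carrier SkewAPM_skew, of "underlying_perm w j" j]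
    assms by (intro underlying_perm_eqI[OF SkewAPM_monomial]) auto

lemma SkewAPM_perm_no_fixpoint:
  assumes "j < m"
  shows "underlying_perm w j \<noteq> j"
  using SkewAPM_perm(2)[OF assms] skew_diag[OF char SkewAPM_carrier SkewAPM_skew assms] by auto

lemma SkewAPM_entry_nonzero_iff:
  assumes "i < m" "j < m"
  shows "w $$ (i, j) \<noteq> 0 \<longleftrightarrow> i = underlying_perm w j"
  using underlying_perm_eqI[OF SkewAPM_monomial assms] SkewAPM_perm[OF assms(2)] by auto

lemma SkewAPM_exponent_perm:
  assumes "j < m"
  shows "exponent w (underlying_perm w j) = exponent w j"
  using skew_entry[OF SkewAPM_carrier SkewAPM_skew assms SkewAPM_perm(1)[OF assms]]
  by (simp add: exponent_def SkewAPM_perm_invol[OF assms])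

lemma SkewAPM_entry:
  assumes "i < j" "j < m"
  shows "w $$ (i, j) = (if i = underlying_perm w j then fls_X_intpow (exponent w j) else 0)"
proof (cases "i = underlying_perm w j")
  case True
  then have "w $$ (i, j) \<noteq> 0" using SkewAPM_perm[OF assms(2)] by simp
  then obtain e where e: "w $$ (i, j) = fls_X_intpow e"
    using w assms unfolding SkewAPM_def by blast
  then have "exponent w j = e" by (simp add: exponent_def flip: True)
  with True e show ?thesis by simp
next
  case False
  then show ?thesis using SkewAPM_entry_nonzero_iff[of i j] assms by auto
qed

lemma SkewAPM_perm_bij: "bij_betw (underlying_perm w) {..<m} {..<m}"
  using SkewAPM_perm SkewAPM_perm_invol
  by (intro bij_betw_byWitness[where f' = "underlying_perm w"]) auto

end

lemma SkewAPM_eqI: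
  fixes w w' :: "'k::field fls mat"
  assumes char: "(2::'k) \<noteq> 0" and w: "w \<in> SkewAPM m" and w': "w' \<in> SkewAPM m"
    and eq: "\<And>j. j < m \<Longrightarrow> underlying_perm w j = underlying_perm w' j"
      "\<And>j. j < m \<Longrightarrow> exponent w j = exponent w' j"
  shows "w = w'"
  using eq
  by (intro skew_eqI[OF char SkewAPM_carrier[OF char w] SkewAPM_skew[OF char w]
        SkewAPM_carrier[OF char w'] SkewAPM_skew[OF char w']])
    (simp add: SkewAPM_entry[OF char w] SkewAPM_entry[OF char w'])

section \<open>Uniqueness of the monomial representative\<close>

text \<open>The weight \<open>m v(w\<^sub>i\<^sub>j) + i + j\<close> of the non-zero entry in column \<open>j\<close>.\<close>

definition col_weight :: "nat \<Rightarrow> 'k::field fls mat \<Rightarrow> nat \<Rightarrow> int" where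
  "col_weight m w j = int m * exponent w j + int j + int (underlying_perm w j)"

text \<open>
  Let \<open>j\<close> be the column paired with \<open>i\<close> by \<open>w'\<close>, and compare the entries at \<open>(i, j)\<close> of \<open>w' b\<^sup>-\<^sup>1 = b\<^sup>T w\<close>: on the left the diagonal entry of
  \<open>b\<^sup>-\<^sup>1\<close> contributes weight 0, on the right an entry of \<open>b\<close> contributes a weight that is
  non-negative, and positive off the diagonal.
\<close>

lemma col_weight_le:
  fixes w w' :: "'k::field fls mat"
  assumes char: "(2::'k) \<noteq> 0" and w: "w \<in> SkewAPM m" and w': "w' \<in> SkewAPM m"
    and b: "b \<in> Iwahori m" and eq: "w' = congr_mat b w" and i: "i < m"
  shows "col_weight m w (underlying_perm w' i) \<le> col_weight m w' i"
    and "col_weight m w (underlying_perm w' i) = col_weight m w' i \<Longrightarrow>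
      underlying_perm w' i = underlying_perm w i"
proof -
  obtain c where c: "c \<in> Iwahori m" "b * c = 1\<^sub>m m" by (rule Iwahori_inverse[OF b])
  note wc = SkewAPM_carrier[OF char w] and w'c = SkewAPM_carrier[OF char w']
  note bc = Iwahori_carrier[OF b] and cc = Iwahori_carrier[OF c(1)]
  have "w' * c = transpose_mat b * w * (b * c)"
    unfolding eq congr_mat_def using wc bc cc by (simp add: assoc_mult_mat[of _ m m _ m _ m])
  also have "\<dots> = transpose_mat b * w" using wc bc c by simp
  finally have key: "w' * c = transpose_mat b * w" .
  define j where "j = underlying_perm w' i"
  define k where "k = underlying_perm w j"
  have j: "j < m" and wij: "w' $$ (i, j) \<noteq> 0"
    using SkewAPM_perm[OF char w' i] SkewAPM_entry_nonzero_iff[OF char w', of i j] i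
      SkewAPM_perm_invol[OF char w' i] by (simp_all add: j_def)
  have k: "k < m" and wkj: "w $$ (k, j) \<noteq> 0"
    using SkewAPM_perm[OF char w j] by (simp_all add: k_def)
  have "(w' * c) $$ (i, j) = (\<Sum>l<m. w' $$ (i, l) * c $$ (l, j))"
    by (rule mult_entry[OF w'c cc i j])
  also have "\<dots> = (\<Sum>l<m. if l = j then w' $$ (i, j) * c $$ (j, j) else 0)"
  proof (intro sum.cong refl)
    fix l assume "l \<in> {..<m}"
    then have "w' $$ (i, l) = 0" if "l \<noteq> j"
      using that SkewAPM_entry_nonzero_iff[OF char w', of i l] SkewAPM_perm_invol[OF char w'] i
      by (auto simp: j_def)
    then show "w' $$ (i, l) * c $$ (l, j) = (if l = j then w' $$ (i, j) * c $$ (j, j) else 0)"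
      by simp
  qed
  also have "\<dots> = w' $$ (i, j) * c $$ (j, j)" using j by simp
  finally have L: "(w' * c) $$ (i, j) = w' $$ (i, j) * c $$ (j, j)" .
  have "(transpose_mat b * w) $$ (i, j) = (\<Sum>l<m. transpose_mat b $$ (i, l) * w $$ (l, j))"
    by (rule mult_entry[OF _ wc i j]) (use bc in simp)
  also have "\<dots> = (\<Sum>l<m. if l = k then b $$ (k, i) * w $$ (k, j) else 0)"
    using SkewAPM_entry_nonzero_iff[OF char w, of _ j] i j bc
    by (intro sum.cong refl) (auto simp: k_def)
  also have "\<dots> = b $$ (k, i) * w $$ (k, j)" using k by simp
  finally have prod: "w' $$ (i, j) * c $$ (j, j) = b $$ (k, i) * w $$ (k, j)"
    using L key by simp
  note cjj = Iwahori_diag[OF c(1) j]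
  have bki: "b $$ (k, i) \<noteq> 0" using prod wij cjj by auto
  have "fls_subdegree (w' $$ (i, j)) = fls_subdegree (b $$ (k, i)) + fls_subdegree (w $$ (k, j))"
    using arg_cong[OF prod, of fls_subdegree] wij wkj bki cjj by simp
  moreover have "exponent w' i = fls_subdegree (w' $$ (i, j))"
    using skew_entry[OF w'c SkewAPM_skew[OF char w'] i j] by (simp add: exponent_def j_def)
  ultimately have weights: "col_weight m w' i
      = int m * fls_subdegree (b $$ (k, i)) + int i - int k + col_weight m w j"
    by (simp add: col_weight_def exponent_def algebra_simps flip: j_def k_def)
  note bw = Iwahori_weight[OF b k i bki]
  show "col_weight m w (underlying_perm w' i) \<le> col_weight m w' i"
    using weights bw(1) by (simp flip: j_def)
  show "underlying_perm w' i = underlying_perm w i"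
    if "col_weight m w (underlying_perm w' i) = col_weight m w' i"
  proof -
    have "k = i" using weights that by (intro bw(2)) (simp flip: j_def)
    then have "underlying_perm w i = j" using SkewAPM_perm_invol[OF char w j] by (simp add: k_def)
    then show ?thesis by (simp add: j_def)
  qed
qed

lemma SkewAPM_congr_unique:
  fixes w w' :: "'k::field fls mat"
  assumes char: "(2::'k) \<noteq> 0" and w: "w \<in> SkewAPM m" and w': "w' \<in> SkewAPM m"
    and b: "b \<in> Iwahori m" and eq: "w' = congr_mat b w"
  shows "w = w'"
proof -
  let ?p = "underlying_perm w" and ?p' = "underlying_perm w'"
  let ?n = "col_weight m w" and ?n' = "col_weight m w'"
  obtain c where c: "c \<in> Iwahori m" "b * c = 1\<^sub>m m" by (rule Iwahori_inverse[OF b])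
  have eq': "w = congr_mat c w'"
    using congr_mult[OF Iwahori_carrier[OF b] Iwahori_carrier[OF c(1)] SkewAPM_carrier[OF char w]]
    by (simp add: eq c congr_one[OF SkewAPM_carrier[OF char w]])
  note le = col_weight_le[OF char w w' b eq] and le' = col_weight_le[OF char w' w c(1) eq']
  have "(\<Sum>i<m. ?n' i) = (\<Sum>i<m. ?n' (?p i))"
    by (rule sum.reindex_bij_betw[OF SkewAPM_perm_bij[OF char w], symmetric])
  also have "\<dots> \<le> (\<Sum>i<m. ?n i)" by (intro sum_mono le') simp
  also have "\<dots> = (\<Sum>i<m. ?n (?p' i))"
    by (rule sum.reindex_bij_betw[OF SkewAPM_perm_bij[OF char w'], symmetric])
  finally have "(\<Sum>i<m. ?n' i) \<le> (\<Sum>i<m. ?n (?p' i))" .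
  then have sum_eq: "(\<Sum>i<m. ?n (?p' i)) = (\<Sum>i<m. ?n' i)"
    using sum_mono[of "{..<m}" "\<lambda>i. ?n (?p' i)" ?n'] le(1) by force
  have n_eq: "?n (?p' i) = ?n' i" if "i < m" for i
    by (rule sum_mono_inv[OF sum_eq]) (use that le(1) in auto)
  have p_eq: "?p i = ?p' i" if "i < m" for i
    using le(2)[OF that n_eq[OF that]] by simp
  show ?thesis
  proof (rule SkewAPM_eqI[OF char w w' p_eq])
    fix i assume i: "i < m"
    have "?n (?p' i) = ?n i"
      using p_eq[OF i, symmetric] SkewAPM_perm_invol[OF char w i] SkewAPM_exponent_perm[OF char w i]
      by (simp add: col_weight_def)
    then have "int m * exponent w i = int m * exponent w' i"
      using n_eq[OF i] p_eq[OF i] by (simp add: col_weight_def)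
    then show "exponent w i = exponent w' i" using i by simp
  qed
qed

section \<open>Reduction to a monomial matrix\<close>

text \<open>
  The rows in \<open>S\<close> of the skew-symmetric matrix \<open>X\<close> are already in final form: \<open>S\<close> is a union of 2-cycles, and each row in \<open>S\<close> has
  its only non-zero entry at its partner, normalized above the diagonal.
\<close>

definition reduced_on :: "nat \<Rightarrow> nat set \<Rightarrow> 'k::field fls mat \<Rightarrow> bool" where
  "reduced_on m S X \<longleftrightarrow> S \<subseteq> {..<m} \<and>
     (\<forall>p\<in>S. \<exists>q\<in>S. X $$ (p, q) \<noteq> 0 \<and> (\<forall>l<m. l \<noteq> q \<longrightarrow> X $$ (p, l) = 0) \<and>
       (p < q \<longrightarrow> (\<exists>e. X $$ (p, q) = fls_X_intpow e)))"

lemma reduced_on_all_imp_SkewAPM: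
  assumes X: "X \<in> carrier_mat m m" "transpose_mat X = - X" and red: "reduced_on m {..<m} X"
  shows "X \<in> SkewAPM m"
proof -
  have row: "\<exists>q<m. X $$ (p, q) \<noteq> 0 \<and> (\<forall>l<m. l \<noteq> q \<longrightarrow> X $$ (p, l) = 0) \<and>
       (p < q \<longrightarrow> (\<exists>e. X $$ (p, q) = fls_X_intpow e))" if "p < m" for p
    using red that unfolding reduced_on_def by blast
  have rows: "\<exists>!j. j < m \<and> X $$ (i, j) \<noteq> 0" if "i < m" for i
    using row[OF that] by blast
  have "\<exists>!i. i < m \<and> X $$ (i, j) \<noteq> 0" if j: "j < m" for j
  proof -
    have "(i < m \<and> X $$ (i, j) \<noteq> 0) = (i < m \<and> X $$ (j, i) \<noteq> 0)" for i
      using skew_entry[OF X _ j, of i] by auto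
    then show ?thesis using rows[OF j] by simp
  qed
  moreover have "\<exists>e. X $$ (i, j) = fls_X_intpow e" if "i < j" "j < m" "X $$ (i, j) \<noteq> 0" for i j
    using row[of i] that by (metis less_trans)
  ultimately show ?thesis
    using X rows unfolding SkewAPM_def monomial_mat_def by blast
qed

lemma reduced_on_partner:
  assumes "X \<in> carrier_mat m m" "transpose_mat X = - X" "reduced_on m S X"
    and "i < m" "i \<notin> S" "j \<in> S"
  shows "X $$ (i, j) = 0" and "X $$ (j, i) = 0"
proof -
  show "X $$ (j, i) = 0" using assms(3-6) unfolding reduced_on_def by metis
  moreover have "j < m" using assms(3,6) by (auto simp: reduced_on_def)
  ultimately show "X $$ (i, j) = 0" using skew_entry[OF assms(1,2,4)] by simp
qed

lemma GL_row_nonzero: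
  fixes X :: "'a::comm_ring_1 mat"
  assumes "X \<in> GL m" "i < m"
  obtains j where "j < m" "X $$ (i, j) \<noteq> 0"
proof -
  obtain h where h: "h \<in> GL m" "X * h = 1\<^sub>m m" by (rule GL_inverse[OF assms(1)])
  have "(\<Sum>k<m. X $$ (i, k) * h $$ (k, i)) = 1"
    using mult_entry[OF GL_carrier[OF assms(1)] GL_carrier[OF h(1)] assms(2,2)] h assms by simp
  then have "\<exists>k<m. X $$ (i, k) \<noteq> 0"
    by (metis (no_types, lifting) lessThan_iff mult_zero_left sum.neutral zero_neq_one)
  then show ?thesis using that by blast
qed

text \<open>
  Among the entries outside the finished rows and columns, take one of minimal weight as a pivot.
  Minimality is exactly what makes the two column operations that clear the pivot rows belong to
  the Iwahori subgroup.
\<close>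

lemma minimal_weight_pivot:
  fixes X :: "'k::field fls mat"
  assumes char: "(2::'k) \<noteq> 0" and X: "X \<in> GL m" "transpose_mat X = - X"
    and red: "reduced_on m S X" and S: "S \<noteq> {..<m}"
  obtains i j where "i < j" "j < m" "i \<notin> S" "j \<notin> S" "X $$ (i, j) \<noteq> 0"
    "\<And>k l. k < m \<Longrightarrow> l < m \<Longrightarrow> k \<notin> S \<Longrightarrow> X $$ (k, l) \<noteq> 0 \<Longrightarrow>
       int m * fls_subdegree (X $$ (i, j)) + int i + int j
         \<le> int m * fls_subdegree (X $$ (k, l)) + int k + int l"
proof -
  note Xc = GL_carrier[OF X(1)]
  define wt where "wt = (\<lambda>(i, j). int m * fls_subdegree (X $$ (i, j)) + int i + int j)"
  define P where "P = {(i, j). i < j \<and> j < m \<and> i \<notin> S \<and> j \<notin> S \<and> X $$ (i, j) \<noteq> 0}"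
  have sym: "\<exists>z\<in>P. wt z = wt (k, l)"
    if kl: "k < m" "l < m" "k \<notin> S" "X $$ (k, l) \<noteq> 0" for k l
  proof -
    have "l \<notin> S" using reduced_on_partner[OF Xc X(2) red kl(1,3), of l] kl by auto
    moreover have "X $$ (l, k) = - X $$ (k, l)" by (rule skew_entry[OF Xc X(2) kl(2,1)])
    moreover have "k \<noteq> l" using skew_diag[OF char Xc X(2)] kl by auto
    ultimately have "(if k < l then (k, l) else (l, k)) \<in> P"
      "wt (if k < l then (k, l) else (l, k)) = wt (k, l)"
      using kl by (auto simp: P_def wt_def)
    then show ?thesis by blast
  qed
  have "finite P" by (rule finite_subset[of _ "{..<m} \<times> {..<m}"]) (auto simp: P_def)
  moreover have "P \<noteq> {}"
  proof -
    obtain i where i: "i < m" "i \<notin> S" using S red unfolding reduced_on_def by auto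
    obtain j where "j < m" "X $$ (i, j) \<noteq> 0" by (rule GL_row_nonzero[OF X(1) i(1)])
    then show ?thesis using sym[of i j] i by auto
  qed
  ultimately obtain z where z: "z \<in> P" "\<And>y. y \<in> P \<Longrightarrow> wt z \<le> wt y"
    using ex_min_if_finite[of "wt ` P"] by (auto simp: not_less)
  obtain i j where ij: "z = (i, j)" by (cases z)
  show ?thesis
  proof (rule that[of i j])
    fix k l assume "k < m" "l < m" "k \<notin> S" "X $$ (k, l) \<noteq> 0"
    then have "wt z \<le> wt (k, l)" using sym z(2) by metis
    then show "int m * fls_subdegree (X $$ (i, j)) + int i + int j
         \<le> int m * fls_subdegree (X $$ (k, l)) + int k + int l"
      by (simp add: wt_def ij)
  qed (use z(1) in \<open>auto simp: P_def ij\<close>)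
qed

lemma reduction_step:
  fixes X :: "'k::field fls mat"
  assumes char: "(2::'k) \<noteq> 0" and X: "X \<in> GL m" "transpose_mat X = - X"
    and red: "reduced_on m S X" and S: "S \<noteq> {..<m}"
  obtains b S' where "b \<in> Iwahori m" "S \<subset> S'" "reduced_on m S' (congr_mat b X)"
proof -
  note Xc = GL_carrier[OF X(1)]
  obtain i j where ij: "i < j" "j < m" "i \<notin> S" "j \<notin> S" and nz: "X $$ (i, j) \<noteq> 0"
    and min: "\<And>k l. k < m \<Longrightarrow> l < m \<Longrightarrow> k \<notin> S \<Longrightarrow> X $$ (k, l) \<noteq> 0 \<Longrightarrow>
       int m * fls_subdegree (X $$ (i, j)) + int i + int j
         \<le> int m * fls_subdegree (X $$ (k, l)) + int k + int l"
    by (rule minimal_weight_pivot[OF assms]) blast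
  have i: "i < m" using ij by simp
  have Xji: "X $$ (j, i) = - X $$ (i, j)" by (rule skew_entry[OF Xc X(2) ij(2) i])
  have diag: "X $$ (k, k) = 0" if "k < m" for k by (rule skew_diag[OF char Xc X(2) that])
  define e where "e = fls_subdegree (X $$ (i, j))"
  define u where "u = fls_X_intpow e / X $$ (i, j)"
  have u: "u \<noteq> 0" "u * X $$ (i, j) = fls_X_intpow e" using nz by (simp_all add: u_def)
  have u_deg: "fls_subdegree u = 0"
    using arg_cong[OF u(2), of fls_subdegree] u(1) nz by (simp add: e_def)
  \<comment> \<open>Column \<open>i\<close> is scaled to turn the pivot into \<open>t\<^sup>e\<close>; every other column \<open>q \<noteq> j\<close> gets multiples of the
    columns \<open>j\<close> and \<open>i\<close> added, clearing its entries in the rows \<open>i\<close> and \<open>j\<close> respectively.\<close>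
  define b where "b = mat m m (\<lambda>(k, q).
    if k = q then (if k = i then u else 1)
    else if q = i \<or> q = j then 0
    else if k = i then - (X $$ (j, q) / X $$ (j, i))
    else if k = j then - (X $$ (i, q) / X $$ (i, j))
    else 0)"
  have bc: "b \<in> carrier_mat m m" by (simp add: b_def)
  have deg_div: "fls_subdegree (f / g) = fls_subdegree f - fls_subdegree g"
    if "f \<noteq> 0" "g \<noteq> 0" for f g :: "'k fls"
    using fls_subdegree_mult[of "f / g" g] that by simp
  have b: "b \<in> Iwahori m"
  proof (rule Iwahori_I[OF bc])
    fix k q assume kq: "k < m" "q < m" "k \<noteq> q" "b $$ (k, q) \<noteq> 0"
    then consider "k = i" "q \<noteq> j" "X $$ (j, q) \<noteq> 0" | "k = j" "q \<noteq> i" "X $$ (i, q) \<noteq> 0"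
      by (auto simp: b_def split: if_splits)
    then show "int k - int q \<le> int m * fls_subdegree (b $$ (k, q))"
    proof cases
      case 1
      then have deg: "fls_subdegree (b $$ (k, q)) = fls_subdegree (X $$ (j, q)) - e"
        using kq nz Xji by (simp add: b_def deg_div e_def)
      show ?thesis
        unfolding deg right_diff_distrib e_def using min[OF ij(2) kq(2) ij(4)] 1 by linarith
    next
      case 2
      then have deg: "fls_subdegree (b $$ (k, q)) = fls_subdegree (X $$ (i, q)) - e"
        using kq nz ij by (simp add: b_def deg_div e_def)
      show ?thesis
        unfolding deg right_diff_distrib e_def using min[OF i kq(2) ij(3)] 2 by linarith
    qed
  qed (use u u_deg in \<open>auto simp: b_def\<close>)
  \<comment> \<open>In \<open>X b\<close> the rows \<open>i\<close> and \<open>j\<close> are clear except at the pivot, and the rows in \<open>S\<close> are those of \<open>X\<close>;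
    on all these rows, left multiplication by \<open>b\<^sup>T\<close> only scales by the diagonal of \<open>b\<close>.\<close>
  define Z where "Z = X * b"
  have Zc: "Z \<in> carrier_mat m m" using Xc bc by (simp add: Z_def)
  have Z_entry: "Z $$ (p, q) = (\<Sum>l<m. X $$ (p, l) * b $$ (l, q))" if "p < m" "q < m" for p q
    unfolding Z_def by (rule mult_entry[OF Xc bc that])
  have two_terms: "(\<Sum>l<m. f l) = f k + f q"
    if "k < m" "q < m" "k \<noteq> q" "\<And>l. l < m \<Longrightarrow> l \<noteq> k \<Longrightarrow> l \<noteq> q \<Longrightarrow> f l = 0"
    for f :: "nat \<Rightarrow> 'k fls" and k q
    using sum.mono_neutral_right[of "{..<m}" "{k, q}" f] that by auto
  have Z_i: "Z $$ (i, q) = (if q = j then X $$ (i, j) else 0)" if q: "q < m" for q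
  proof (cases "q = i \<or> q = j")
    case True
    have "Z $$ (i, q) = X $$ (i, i) * b $$ (i, q) + X $$ (i, j) * b $$ (j, q)"
      unfolding Z_entry[OF i q] using ij i True q by (intro two_terms) (auto simp: b_def)
    then show ?thesis using diag[OF i] True ij i by (auto simp: b_def)
  next
    case False
    have "Z $$ (i, q) = X $$ (i, q) * b $$ (q, q) + X $$ (i, j) * b $$ (j, q)"
      unfolding Z_entry[OF i q] using ij i False q diag[OF i]
      by (intro two_terms) (auto simp: b_def)
    then show ?thesis using False ij q nz by (simp add: b_def)
  qed
  have Z_j: "Z $$ (j, q) = (if q = i then X $$ (j, i) * u else 0)" if q: "q < m" for q
  proof (cases "q = i \<or> q = j")
    case True
    have "Z $$ (j, q) = X $$ (j, i) * b $$ (i, q) + X $$ (j, j) * b $$ (j, q)"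
      unfolding Z_entry[OF ij(2) q] using ij i True q by (intro two_terms) (auto simp: b_def)
    then show ?thesis using diag[OF ij(2)] True ij i by (auto simp: b_def)
  next
    case False
    have "Z $$ (j, q) = X $$ (j, q) * b $$ (q, q) + X $$ (j, i) * b $$ (i, q)"
      unfolding Z_entry[OF ij(2) q] using ij i False q diag[OF ij(2)]
      by (intro two_terms) (auto simp: b_def)
    then show ?thesis using False ij i q nz Xji by (simp add: b_def)
  qed
  have Sm: "S \<subseteq> {..<m}" using red by (simp add: reduced_on_def)
  have Z_S: "Z $$ (p, q) = X $$ (p, q)" if p: "p \<in> S" and q: "q < m" for p q
  proof -
    have pm: "p < m" using p Sm by auto
    have "X $$ (p, l) * b $$ (l, q) = (if l = q then X $$ (p, q) else 0)" if l: "l < m" for l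
    proof (cases "l \<in> S")
      case True
      then have "l \<noteq> i" "l \<noteq> j" using ij by auto
      then show ?thesis using l q by (simp add: b_def)
    next
      case False
      then show ?thesis using reduced_on_partner(2)[OF Xc X(2) red l False p] by auto
    qed
    then show ?thesis unfolding Z_entry[OF pm q] using q by simp
  qed
  define Y where "Y = congr_mat b X"
  have Y: "Y = transpose_mat b * Z"
    unfolding Y_def congr_mat_def Z_def using bc Xc by (simp add: assoc_mult_mat[of _ m m _ m _ m])
  let ?S' = "insert i (insert j S)"
  have Y_entry: "Y $$ (p, q) = b $$ (p, p) * Z $$ (p, q)" if p: "p \<in> ?S'" and q: "q < m" for p q
  proof -
    have pm: "p < m" using p Sm i ij by auto
    have "b $$ (k, p) = 0" if "k < m" "k \<noteq> p" for k
      using reduced_on_partner(1)[OF Xc X(2) red i ij(3), of p]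
        reduced_on_partner(1)[OF Xc X(2) red ij(2) ij(4), of p] p pm that
      by (auto simp: b_def)
    then have "(\<Sum>k<m. transpose_mat b $$ (p, k) * Z $$ (k, q))
        = (\<Sum>k<m. if k = p then b $$ (p, p) * Z $$ (p, q) else 0)"
      using bc pm by (intro sum.cong) auto
    also have "\<dots> = b $$ (p, p) * Z $$ (p, q)" using pm by simp
    finally show ?thesis
      unfolding Y using bc by (subst mult_entry[OF _ Zc pm q, of "transpose_mat b"]) simp_all
  qed
  have "reduced_on m ?S' Y"
    unfolding reduced_on_def
  proof (intro conjI ballI)
    show "?S' \<subseteq> {..<m}" using Sm i ij by auto
    fix p assume p: "p \<in> ?S'"
    consider (i) "p = i" | (j) "p = j" | (S) "p \<in> S" using p by auto
    then show "\<exists>q\<in>?S'. Y $$ (p, q) \<noteq> 0 \<and> (\<forall>l<m. l \<noteq> q \<longrightarrow> Y $$ (p, l) = 0) \<and>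
       (p < q \<longrightarrow> (\<exists>e. Y $$ (p, q) = fls_X_intpow e))"
    proof cases
      case i
      have "Y $$ (i, q) = (if q = j then fls_X_intpow e else 0)" if "q < m" for q
        using Y_entry[of i q] Z_i that u(2) \<open>i < m\<close> by (simp add: b_def)
      with i ij show ?thesis by (intro bexI[of _ j]) auto
    next
      case j
      have "Y $$ (j, q) = (if q = i then X $$ (j, i) * u else 0)" if "q < m" for q
        using Y_entry[of j q] Z_j that ij by (simp add: b_def)
      with j ij \<open>i < m\<close> Xji nz u show ?thesis by (intro bexI[of _ i]) auto
    next
      case S
      then have "p < m" "p \<noteq> i" using Sm ij by auto
      then have "Y $$ (p, q) = X $$ (p, q)" if "q < m" for q
        using Y_entry[OF p that] Z_S[OF S that] by (simp add: b_def)
      moreover obtain q where q: "q \<in> S" "X $$ (p, q) \<noteq> 0" "\<forall>l<m. l \<noteq> q \<longrightarrow> X $$ (p, l) = 0"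
        "p < q \<longrightarrow> (\<exists>e. X $$ (p, q) = fls_X_intpow e)"
        using red S unfolding reduced_on_def by blast
      moreover have "q < m" using q Sm by auto
      ultimately show ?thesis using q by (intro bexI[of _ q]) simp_all
    qed
  qed
  moreover have "S \<subset> ?S'" using ij by auto
  ultimately show ?thesis using that b unfolding Y_def by blast
qed

lemma reduction_induct:
  fixes X :: "'k::field fls mat"
  assumes char: "(2::'k) \<noteq> 0" and "X \<in> GL m" "transpose_mat X = - X" "reduced_on m S X"
  shows "\<exists>b\<in>Iwahori m. reduced_on m {..<m} (congr_mat b X)"
  using assms(2-)
proof (induction "card ({..<m} - S)" arbitrary: S X rule: less_induct)
  case less
  note Xc = GL_carrier[OF less.prems(1)]
  show ?case
  proof (cases "S = {..<m}")
    case True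
    then show ?thesis using less.prems Iwahori_one congr_one[OF Xc] by metis
  next
    case False
    obtain b S' where b: "b \<in> Iwahori m" and S': "S \<subset> S'" "reduced_on m S' (congr_mat b X)"
      by (rule reduction_step[OF char less.prems False])
    have "{..<m} - S' \<subset> {..<m} - S" using S' by (auto simp: reduced_on_def)
    then have "card ({..<m} - S') < card ({..<m} - S)" by (intro psubset_card_mono) auto
    then obtain c where c: "c \<in> Iwahori m" "reduced_on m {..<m} (congr_mat c (congr_mat b X))"
      using less.hyps[of S' "congr_mat b X"] S'(2) congr_GL[OF Iwahori_GL[OF b] less.prems(1)]
        congr_skew[OF Iwahori_carrier[OF b] Xc less.prems(2)] by blast
    then show ?thesis
      using congr_mult[OF Iwahori_carrier[OF b] Iwahori_carrier[OF c(1)] Xc] Iwahori_mult[OF b c(1)]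
      by metis
  qed
qed

lemma exists_SkewAPM_congr:
  fixes X :: "'k::field fls mat"
  assumes char: "(2::'k) \<noteq> 0" and X: "X \<in> GL m" "transpose_mat X = - X"
  obtains b where "b \<in> Iwahori m" "congr_mat b X \<in> SkewAPM m"
proof -
  have "reduced_on m {} X" by (simp add: reduced_on_def)
  then obtain b where "b \<in> Iwahori m" "reduced_on m {..<m} (congr_mat b X)"
    using reduction_induct[OF char X] by blast
  then show ?thesis
    using that[of b] reduced_on_all_imp_SkewAPM[of "congr_mat b X" m]
      congr_carrier[of b m X] congr_skew[of b m X] Iwahori_carrier[of b m] GL_carrier[OF X(1)] X(2)
    by simp
qed

section \<open>The explicit representatives\<close>

lemma perm_mat_carrier [simp]: "perm_mat m \<pi> \<in> carrier_mat m m"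
  by (simp add: perm_mat_def)

lemma tau_mat_carrier [simp]: "tau_mat m c \<in> carrier_mat m m"
  by (simp add: tau_mat_def)

lemma congr_perm_mat_entry:
  assumes M: "M \<in> carrier_mat m m" and \<pi>: "\<And>x. x < m \<Longrightarrow> \<pi> x < m" and ab: "a < m" "b < m"
  shows "congr_mat (perm_mat m \<pi>) M $$ (a, b) = M $$ (\<pi> a, \<pi> b)"
proof -
  let ?P = "perm_mat m \<pi>"
  have PM: "transpose_mat ?P * M \<in> carrier_mat m m"
    using M by (intro mult_carrier_mat[of _ m m]) simp_all
  have left: "(transpose_mat ?P * M) $$ (a, k) = M $$ (\<pi> a, k)" if "k < m" for k
  proof -
    have "(transpose_mat ?P * M) $$ (a, k) = (\<Sum>l<m. transpose_mat ?P $$ (a, l) * M $$ (l, k))"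
      by (rule mult_entry[OF _ M ab(1) that]) simp
    also have "\<dots> = (\<Sum>l<m. if l = \<pi> a then M $$ (l, k) else 0)"
      using ab by (intro sum.cong) (auto simp: perm_mat_def)
    finally show ?thesis using \<pi>[OF ab(1)] by simp
  qed
  have "congr_mat ?P M $$ (a, b) = (\<Sum>k<m. (transpose_mat ?P * M) $$ (a, k) * ?P $$ (k, b))"
    unfolding congr_mat_def by (rule mult_entry[OF PM _ ab]) simp
  also have "\<dots> = (\<Sum>k<m. if k = \<pi> b then M $$ (\<pi> a, k) else 0)"
    using ab left by (intro sum.cong) (auto simp: perm_mat_def)
  finally show ?thesis using \<pi>[OF ab(2)] by simp
qed

lemma perm_mat_GL:
  assumes "bij_betw \<pi> {..<m} {..<m}"
  shows "(perm_mat m \<pi> :: 'a::field mat) \<in> GL m"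
proof (rule GL_left_inverse)
  have \<pi>: "\<pi> x < m" if "x < m" for x using assms that by (auto simp: bij_betw_def)
  have "congr_mat (perm_mat m \<pi> :: 'a mat) (1\<^sub>m m) = 1\<^sub>m m"
  proof (rule eq_matI)
    fix a b assume "a < dim_row (1\<^sub>m m :: 'a mat)" "b < dim_col (1\<^sub>m m :: 'a mat)"
    then show "congr_mat (perm_mat m \<pi>) (1\<^sub>m m) $$ (a, b) = (1\<^sub>m m :: 'a mat) $$ (a, b)"
      using congr_perm_mat_entry[of "1\<^sub>m m :: 'a mat" m \<pi> a b] \<pi> assms
      by (auto simp: bij_betw_def dest: inj_onD)
  qed (simp_all add: congr_mat_def perm_mat_def)
  then show "transpose_mat (perm_mat m \<pi>) * (perm_mat m \<pi> :: 'a mat) = 1\<^sub>m m"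
    by (simp add: congr_mat_def right_mult_one_mat[of _ m])
qed simp_all

lemma congr_tau_mat_entry:
  fixes M :: "'k::field fls mat"
  assumes M: "M \<in> carrier_mat m m" and ab: "a < m" "b < m"
  shows "congr_mat (tau_mat m c) M $$ (a, b) = fls_X_intpow (c a) * M $$ (a, b) * fls_X_intpow (c b)"
proof -
  have "transpose_mat (tau_mat m c) = (tau_mat m c :: 'k fls mat)"
    by (auto simp: tau_mat_def mat_diag_def)
  then show ?thesis
    using M ab by (simp add: congr_mat_def tau_mat_def mat_diag_mult_left[OF M]
        mat_diag_mult_right[of _ m m])
qed

lemma tau_mat_GL: "tau_mat m c \<in> GL m"
proof (rule GL_left_inverse)
  have "fls_X_intpow (- e) * fls_X_intpow e = (1 :: 'a fls)" for e
    using fls_X_intpow_times_fls_X_intpow[of "- e" e, where 'a = 'a] by simp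
  then show "tau_mat m (\<lambda>j. - c j) * tau_mat m c = (1\<^sub>m m :: 'a fls mat)"
    unfolding tau_mat_def mat_diag_diag by (auto simp: mat_diag_def)
qed simp_all

text \<open>
  After \<open>j\<close> steps the involution \<open>v\<close> is still fixed-point-free on the \<open>2n\<close> points, is conjugate to
  the original one by \<open>\<sigma>\<close>, and pairs \<open>i\<close> with \<open>i + n\<close> for all \<open>i < j\<close>.
\<close>

lemma sigma_step_invariant:
  assumes u: "\<And>x. x < 2 * n \<Longrightarrow> u x < 2 * n \<and> u (u x) = x \<and> u x \<noteq> x" and "j \<le> n"
  shows "(\<forall>x<2*n. involution_step n u j x < 2 * n
        \<and> involution_step n u j (involution_step n u j x) = x \<and> involution_step n u j x \<noteq> x)
    \<and> (\<forall>i<j. involution_step n u j i = i + n)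
    \<and> bij_betw (sigma_step n u j) {..<2*n} {..<2*n}
    \<and> (\<forall>x<2*n. sigma_step n u j (u x) = involution_step n u j (sigma_step n u j x))"
  using \<open>j \<le> n\<close>
proof (induction j)
  case 0
  then show ?case using u by (simp add: bij_betw_def)
next
  case (Suc j)
  let ?v = "involution_step n u j" and ?\<sigma> = "sigma_step n u j"
  have j: "j < n" using Suc.prems by simp
  have v: "?v x < 2 * n" "?v (?v x) = x" "?v x \<noteq> x" if "x < 2 * n" for x
    using Suc that by auto
  have vi: "?v i = i + n" if "i < j" for i using Suc that by auto
  have \<sigma>: "bij_betw ?\<sigma> {..<2*n} {..<2*n}" using Suc by auto
  have \<sigma>_lt: "?\<sigma> x < 2 * n" if "x < 2 * n" for x using \<sigma> that by (auto simp: bij_betw_def)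
  have conj: "?\<sigma> (u x) = ?v (?\<sigma> x)" if "x < 2 * n" for x using Suc that by auto
  show ?case
  proof (cases "?v j = j + n")
    case True
    then show ?thesis using v vi \<sigma> conj by (auto simp: less_Suc_eq Let_def)
  next
    case False
    let ?\<rho> = "rho n ?v j"
    have \<rho>_lt: "?\<rho> x < 2 * n" if "x < 2 * n" for x
      using that v(1)[of j] j by (auto simp: rho_def transpose_def)
    have \<rho>_\<rho>: "?\<rho> (?\<rho> x) = x" for x by (simp add: rho_def)
    have \<rho>_bij: "bij_betw ?\<rho> {..<2*n} {..<2*n}"
      using \<rho>_lt \<rho>_\<rho> by (intro bij_betw_byWitness[where f' = ?\<rho>]) auto
    have v_j: "?v j \<noteq> j" "?v j < 2 * n" using v[of j] j by auto
    have \<rho>_fix: "?\<rho> i = i" if "i < j" for i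
      using that j v(2)[of j] vi[OF that] by (auto simp: rho_def transpose_def)
    have \<rho>_fix': "?\<rho> (i + n) = i + n" if "i < j" for i
    proof -
      have "?v j \<noteq> i + n" using vi[OF that] v(2)[of j] v(2)[of i] j that by auto
      then show ?thesis using that by (auto simp: rho_def transpose_def)
    qed
    have \<rho>_j: "?\<rho> j = j" using v_j j by (auto simp: rho_def transpose_def)
    have \<rho>_vj: "?\<rho> (?v j) = j + n" by (simp add: rho_def)
    have step: "involution_step n u (Suc j) = ?\<rho> \<circ> ?v \<circ> ?\<rho>" "sigma_step n u (Suc j) = ?\<rho> \<circ> ?\<sigma>"
      using False by (simp_all add: Let_def)
    have "?\<rho> (?v (?\<rho> x)) < 2 * n \<and> ?\<rho> (?v (?\<rho> (?\<rho> (?v (?\<rho> x))))) = x \<and> ?\<rho> (?v (?\<rho> x)) \<noteq> x"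
      if "x < 2 * n" for x
      using v[OF \<rho>_lt[OF that]] \<rho>_lt \<rho>_\<rho> by metis
    moreover have "?\<rho> (?v (?\<rho> i)) = i + n" if "i < Suc j" for i
      using that \<rho>_fix \<rho>_fix' vi \<rho>_j \<rho>_vj by (cases "i = j") auto
    moreover have "bij_betw (?\<rho> \<circ> ?\<sigma>) {..<2*n} {..<2*n}" by (rule bij_betw_trans[OF \<sigma> \<rho>_bij])
    ultimately show ?thesis unfolding step using conj \<rho>_\<rho> by (auto simp: o_def)
  qed
qed

context
  fixes w :: "'k::field fls mat" and n :: nat
  assumes char: "(2::'k) \<noteq> 0" and w: "w \<in> SkewAPM (2 * n)"
begin

private abbreviation "u \<equiv> underlying_perm w"

private lemma u: "x < 2 * n \<Longrightarrow> u x < 2 * n \<and> u (u x) = x \<and> u x \<noteq> x"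
  using SkewAPM_perm[OF char w] SkewAPM_perm_invol[OF char w] SkewAPM_perm_no_fixpoint[OF char w]
  by auto

lemma sigma_bij: "bij_betw (sigma n w) {..<2*n} {..<2*n}"
  using sigma_step_invariant[of n u n] u by (simp add: sigma_def)

lemma sigma_less: "x < 2 * n \<Longrightarrow> sigma n w x < 2 * n"
  using sigma_bij by (auto simp: bij_betw_def)

text \<open>The matrix \<open>\<sigma>\<^sub>w\<^sup>T J \<sigma>\<^sub>w\<close> is supported exactly on the underlying permutation of \<open>w\<close>.\<close>

lemma J_sigma_entry:
  assumes ab: "a < 2 * n" "b < 2 * n"
  shows "(J_mat n :: 'k fls mat) $$ (sigma n w a, sigma n w b) \<noteq> 0 \<longleftrightarrow> b = u a"
proof -
  let ?v = "involution_step n u n"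
  have v: "?v x < 2 * n" "?v (?v x) = x" if "x < 2 * n" for x
    using sigma_step_invariant[of n u n] u that by auto
  have v_small: "?v x = x + n" if "x < n" for x
    using sigma_step_invariant[of n u n] u that by auto
  have v_iff: "y = ?v x \<longleftrightarrow> y = x + n \<or> x = y + n" if "x < 2 * n" "y < 2 * n" for x y
  proof (cases "x < n")
    case False
    then have "?v (x - n) = x" using v_small[of "x - n"] that by simp
    then have "?v x = x - n" using v(2)[of "x - n"] that by simp
    then show ?thesis using that False by auto
  qed (use v_small that in auto)
  have conj: "sigma n w (u a) = ?v (sigma n w a)"
    using sigma_step_invariant[of n u n] u ab by (auto simp: sigma_def)
  have "(J_mat n :: 'k fls mat) $$ (sigma n w a, sigma n w b) \<noteq> 0
      \<longleftrightarrow> sigma n w b = ?v (sigma n w a)"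
    using v_iff sigma_less ab by (simp add: J_entry)
  also have "\<dots> \<longleftrightarrow> b = u a"
    using sigma_bij u[OF ab(1)] ab by (auto simp: bij_betw_def conj[symmetric] dest: inj_onD)
  finally show ?thesis .
qed

private lemma sign_perm_eq:
  assumes "j < 2 * n"
  shows "sign_perm n w j = (if (J_mat n :: 'k fls mat)
    $$ (sigma n w (min (u j) j), sigma n w (max (u j) j)) = - 1 then u j else j)"
  unfolding sign_perm_def Let_def congr_mat_def[symmetric]
  using assms u[OF assms]
  by (subst congr_perm_mat_entry[OF J_carrier sigma_less]) (auto simp: min_def max_def)

private lemma sign_perm_u:
  assumes "j < 2 * n"
  shows "sign_perm n w (u j) = u (sign_perm n w j)"
  using u[OF assms] by (simp add: sign_perm_eq assms min.commute[of j] max.commute[of j])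

private lemma sign_perm_less: "j < 2 * n \<Longrightarrow> sign_perm n w j < 2 * n"
  using u by (simp add: sign_perm_eq)

private lemma sign_perm_invol:
  assumes "j < 2 * n"
  shows "sign_perm n w (sign_perm n w j) = j"
proof (cases "sign_perm n w j = j")
  case False
  then have "sign_perm n w j = u j" using assms by (simp add: sign_perm_eq split: if_splits)
  then show ?thesis using sign_perm_u[OF assms] u[OF assms] by simp
qed simp

private lemma sign_perm_bij: "bij_betw (sign_perm n w) {..<2*n} {..<2*n}"
  using sign_perm_less sign_perm_invol
  by (intro bij_betw_byWitness[where f' = "sign_perm n w"]) auto

lemma g_mat_GL: "g_mat n w \<in> GL (2 * n)"
  unfolding g_mat_def
  by (intro GL_mult perm_mat_GL tau_mat_GL sigma_bij sign_perm_bij)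

text \<open>
  The involution \<open>s\<close> exchanges the two points of each 2-cycle at which \<open>\<sigma>\<^sub>w\<^sup>T J \<sigma>\<^sub>w\<close> is \<open>-1\<close> above the
  diagonal, which turns this entry into \<open>1\<close>; the factor \<open>\<tau>\<close> contributes the whole power of \<open>t\<close> at the
  smaller point of the 2-cycle.
\<close>

lemma g_mat_Gram: "congr_mat (g_mat n w) (J_mat n) = w"
proof -
  let ?s = "sign_perm n w" and ?r = "sqrt_exponent w"
  let ?M = "\<lambda>a b. (J_mat n :: 'k fls mat) $$ (sigma n w a, sigma n w b)"
  define X where "X = congr_mat (g_mat n w) (J_mat n)"
  have X_skew: "X \<in> carrier_mat (2 * n) (2 * n)" "transpose_mat X = - X"
    unfolding X_def using GL_carrier[OF g_mat_GL] J_carrier J_skew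
    by (auto intro: congr_carrier congr_skew)
  have X_entry: "X $$ (a, b) = fls_X_intpow (?r (?s a)) * ?M (?s a) (?s b) * fls_X_intpow (?r (?s b))"
    if "a < 2 * n" "b < 2 * n" for a b
  proof -
    let ?P = "perm_mat (2 * n) (sigma n w) :: 'k fls mat" and ?T = "tau_mat (2 * n) ?r"
    have "X = congr_mat (perm_mat (2 * n) ?s) (congr_mat ?T (congr_mat ?P (J_mat n)))"
      unfolding X_def g_mat_def
      by (simp only: J_carrier perm_mat_carrier
          congr_mult[OF mult_carrier_mat[OF perm_mat_carrier tau_mat_carrier] perm_mat_carrier J_carrier]
          congr_mult[OF perm_mat_carrier tau_mat_carrier J_carrier])
    then show ?thesis
      using that sign_perm_less
      by (simp add: congr_perm_mat_entry[where m = "2 * n"] congr_tau_mat_entry sigma_less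
          congr_carrier J_carrier)
  qed
  have "X $$ (a, b) = w $$ (a, b)" if ab: "a < b" "b < 2 * n" for a b
  proof (cases "a = u b")
    case False
    have a: "a < 2 * n" using ab by simp
    have "?s b \<noteq> u (?s a)"
      using False sign_perm_u[OF a] sign_perm_invol u[OF a] ab by metis
    then have "?M (?s a) (?s b) = 0"
      using J_sigma_entry[of "?s a" "?s b"] sign_perm_less a ab by auto
    then show ?thesis
      using X_entry[OF a ab(2)] SkewAPM_entry[OF char w ab] False by simp
  next
    case True
    have a: "a < 2 * n" using ab by simp
    have ua: "u a = b" using True u[OF ab(2)] by simp
    have r: "?r a = exponent w b" "?r b = 0"
      using SkewAPM_exponent_perm[OF char w ab(2)] ab ua True
      by (auto simp: sqrt_exponent_def)
    have M: "?M a b \<noteq> 0" "?M b a = - ?M a b"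
      using J_sigma_entry[OF a ab(2)] ua
        skew_entry[OF J_carrier J_skew sigma_less[OF ab(2)] sigma_less[OF a]]
      by (simp_all del: index_uminus_mat)
    have s: "?s a = (if ?M a b = - 1 then b else a)" "?s b = (if ?M a b = - 1 then a else b)"
      using sign_perm_eq[OF a] sign_perm_eq[OF ab(2)] ab ua True
      by (auto simp: min_def max_def)
    have "?M a b = 1 \<or> ?M a b = - 1"
      using M(1) sigma_less a ab by (simp add: J_entry split: if_splits)
    then have "X $$ (a, b) = fls_X_intpow (exponent w b)"
      unfolding X_entry[OF a ab(2)] by (elim disjE) (simp_all add: M(2) s r)
    then show ?thesis using SkewAPM_entry[OF char w ab] True by simp
  qed
  then have "X = w"
    by (intro skew_eqI[OF char X_skew SkewAPM_carrier[OF char w] SkewAPM_skew[OF char w]])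
  then show ?thesis by (simp add: X_def)
qed

end

section \<open>Double cosets\<close>

lemma double_coset_self:
  assumes "g \<in> carrier_mat (2 * n) (2 * n)"
  shows "g \<in> double_coset (Sp n) g (Iwahori (2 * n))"
  unfolding double_coset_def mem_Collect_eq
  by (intro exI[of _ "1\<^sub>m (2 * n)"] conjI Sp_one Iwahori_one) (use assms in simp)

lemma double_coset_eq:
  assumes g: "g \<in> carrier_mat (2 * n) (2 * n)" and k: "k \<in> Sp n" and b: "b \<in> Iwahori (2 * n)"
  shows "double_coset (Sp n) (k * g * b) (Iwahori (2 * n)) = double_coset (Sp n) g (Iwahori (2 * n))"
proof -
  let ?m = "2 * n"
  note Spc = GL_carrier[OF conjunct1[OF Sp_iff[THEN iffD1]]]
  note assoc = assoc_mult_mat[of _ ?m ?m _ ?m _ ?m]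
  obtain k' where k': "k' \<in> Sp n" "k' * k = 1\<^sub>m ?m" by (rule Sp_inverse[OF k])
  obtain b' where b': "b' \<in> Iwahori ?m" "b * b' = 1\<^sub>m ?m" by (rule Iwahori_inverse[OF b])
  note c = g Spc[OF k] Spc[OF k'(1)] Iwahori_carrier[OF b] Iwahori_carrier[OF b'(1)]
  show ?thesis
  proof (intro equalityI subsetI)
    fix x assume "x \<in> double_coset (Sp n) (k * g * b) (Iwahori ?m)"
    then obtain l d where l: "l \<in> Sp n" and d: "d \<in> Iwahori ?m" and x: "x = l * (k * g * b) * d"
      by (auto simp: double_coset_def)
    have "x = (l * k) * g * (b * d)"
      unfolding x using c Spc[OF l] Iwahori_carrier[OF d] by (simp add: assoc)
    then show "x \<in> double_coset (Sp n) g (Iwahori ?m)"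
      using Sp_mult[OF l k] Iwahori_mult[OF b d] by (auto simp: double_coset_def)
  next
    fix x assume "x \<in> double_coset (Sp n) g (Iwahori ?m)"
    then obtain l d where l: "l \<in> Sp n" and d: "d \<in> Iwahori ?m" and x: "x = l * g * d"
      by (auto simp: double_coset_def)
    note cl = Spc[OF l] and cd = Iwahori_carrier[OF d]
    have "(l * k') * (k * g * b) * (b' * d) = l * (k' * k) * g * ((b * b') * d)"
      using c cl cd by (simp add: assoc)
    also have "\<dots> = x" unfolding x k'(2) b'(2) using g cl cd by simp
    finally show "x \<in> double_coset (Sp n) (k * g * b) (Iwahori ?m)"
      using Sp_mult[OF l k'(1)] Iwahori_mult[OF b'(1) d] by (force simp: double_coset_def)
  qed
qed

theorem corollary1p10:
  fixes n :: nat
  assumes "n > 0"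
    and "quadratically_closed TYPE('k::field)"
  shows "bij_betw (\<lambda>w. double_coset (Sp n) (g_mat n w) (Iwahori (2 * n)))
           (SkewAPM (2 * n) :: 'k fls mat set)
           (double_cosets (Sp n) (GL (2 * n)) (Iwahori (2 * n)))"
proof -
  let ?m = "2 * n"
  let ?D = "\<lambda>g :: 'k fls mat. double_coset (Sp n) g (Iwahori ?m)"
  have char: "(2::'k) \<noteq> 0" using assms(2) by (simp add: quadratically_closed_def)
  have "inj_on (\<lambda>w. ?D (g_mat n w)) (SkewAPM ?m)"
  proof (rule inj_onI)
    fix w w' :: "'k fls mat"
    assume w: "w \<in> SkewAPM ?m" and w': "w' \<in> SkewAPM ?m" and eq: "?D (g_mat n w) = ?D (g_mat n w')"
    note g = GL_carrier[OF g_mat_GL[OF char w]] and g' = GL_carrier[OF g_mat_GL[OF char w']]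
    have "g_mat n w' \<in> ?D (g_mat n w)" unfolding eq by (rule double_coset_self[OF g'])
    then obtain k b where k: "k \<in> Sp n" and b: "b \<in> Iwahori ?m"
      and kgb: "g_mat n w' = k * g_mat n w * b"
      unfolding double_coset_def by blast
    have kc: "k \<in> carrier_mat ?m ?m" and kJ: "congr_mat k (J_mat n) = J_mat n"
      using k GL_carrier by (auto simp: Sp_iff)
    have "w' = congr_mat (k * g_mat n w * b) (J_mat n)"
      using g_mat_Gram[OF char w'] kgb by simp
    also have "\<dots> = congr_mat b (congr_mat (g_mat n w) (congr_mat k (J_mat n)))"
      using congr_mult[OF mult_carrier_mat[OF kc g] Iwahori_carrier[OF b] J_carrier]
        congr_mult[OF kc g J_carrier] by simp
    also have "\<dots> = congr_mat b w" using kJ g_mat_Gram[OF char w] by simp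
    finally show "w = w'" by (rule SkewAPM_congr_unique[OF char w w' b])
  qed
  moreover have "(\<lambda>w. ?D (g_mat n w)) ` SkewAPM ?m = double_cosets (Sp n) (GL ?m) (Iwahori ?m)"
  proof (intro equalityI subsetI)
    fix D assume "D \<in> (\<lambda>w. ?D (g_mat n w)) ` SkewAPM ?m"
    then show "D \<in> double_cosets (Sp n) (GL ?m) (Iwahori ?m)"
      using g_mat_GL[OF char] by (auto simp: double_cosets_def)
  next
    fix D :: "'k fls mat set" assume "D \<in> double_cosets (Sp n) (GL ?m) (Iwahori ?m)"
    then obtain g where g: "g \<in> GL ?m" and D: "D = ?D g" by (auto simp: double_cosets_def)
    note gc = GL_carrier[OF g]
    obtain b where b: "b \<in> Iwahori ?m" and w: "congr_mat b (congr_mat g (J_mat n)) \<in> SkewAPM ?m"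
      by (rule exists_SkewAPM_congr[OF char congr_GL[OF g J_GL] congr_skew[OF gc J_carrier J_skew]])
    let ?w = "congr_mat b (congr_mat g (J_mat n))"
    note bc = Iwahori_carrier[OF b]
    have "congr_mat (g * b) (J_mat n) = congr_mat (g_mat n ?w) (J_mat n)"
      using congr_mult[OF gc bc J_carrier] g_mat_Gram[OF char w] by simp
    then obtain k where k: "k \<in> Sp n" "g * b = k * g_mat n ?w"
      by (rule same_Gram_imp_Sp_translate[OF GL_mult[OF g Iwahori_GL[OF b]] g_mat_GL[OF char w]])
    have "D = ?D (1\<^sub>m ?m * g * b)" unfolding D using double_coset_eq[OF gc Sp_one b] by simp
    also have "1\<^sub>m ?m * g * b = k * g_mat n ?w * 1\<^sub>m ?m"
      using right_mult_one_mat[OF mult_carrier_mat[OF gc bc]] by (simp add: left_mult_one_mat[OF gc] k(2))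
    also have "?D (k * g_mat n ?w * 1\<^sub>m ?m) = ?D (g_mat n ?w)"
      by (rule double_coset_eq[OF GL_carrier[OF g_mat_GL[OF char w]] k(1) Iwahori_one])
    finally show "D \<in> (\<lambda>w. ?D (g_mat n w)) ` SkewAPM ?m" using w by blast
  qed
  ultimately show ?thesis by (simp add: bij_betw_def)
qed

end
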